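(* Let $w$ be a pattern over a finite alphabet $\mathcal{A}$ and let $\Gamma=(Q,o,F,\alpha,\delta,\gamma)$ be a $w$-matching machine. If a text $t$ follows an iid model $\pi$ and $\Gamma$ is non-redundant (resp. standard), then the sequence of states parsed by the generic algorithm on the input $(\Gamma,t)$ follows a Markov model $M=(\pi_M,\delta_M)$, where for all states $q$ and $q'$: - $\pi_M(q)=1$ if $q=o$, and $\pi_M(q)=0$ otherwise; - $\delta_M(q,q')=\sum_{x:\,\delta(q,x)=q'}\pi(x)$ if $\Gamma$ is not redundant; - $\delta_M(q,q')=\dfrac{\sum_{x:\,\delta(q,x)=q'}\pi(x)}{\sum_{x:\,\delta(q,x)\neq\odot}\pi(x)}$ if $\Gamma$ is standard, where $\odot$ is the sink state of $\Gamma$.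
   Context: Words (texts, patterns) are finite sequences over $\mathcal{A}$, indexed from $0$; $|v|$ is the length of $v$. **Matching machines.** A $w$-matching machine is a 6-tuple $\Gamma=(Q,o,F,\alpha,\delta,\gamma)$: $Q$ a finite set of states, $o\in Q$ the initial state, $F\subset Q$ the pre-match states, $\alpha:Q\to\mathbb{N}$ the next-position-to-check function, with $\alpha(q)<|w|$ for all $q\in F$, $\delta:Q\times\mathcal{A}\to Q$ the transition function, $\gamma:Q\times\mathcal{A}\to\mathbb{N}$ the shift function. By convention the set of states of a matching machine always contains a sink state $\odot$ with $\delta(\odot,x)=\odot$ and $\gamma(\odot,x)=0$ for all $x\in\mathcal A$. The order of $\Gamma$ is $O_\Gamma=\max_{q\in Q}\alpha(q)$. **Generic algorithm** on $(\Gamma,t)$: start with $(q,p)=(o,0)$; while $p\le|t|-|w|$: if $q\in F$ and $t_{p+\alpha(q)}=w_{\alpha(q)}$, report an occurrence at position $p$; then replace $(q,p)$ by $(\delta(q,t_{p+\alpha(q)}),\,p+\gamma(q,t_{p+\alpha(q)}))$. The sequence of states parsed is the sequence of values of $q$ at the beginning of the successive iterations; each iteration accesses the text position $p+\alpha(q)$. $\Gamma$ is *redundant* if there is a text $t$ for which a position is accessed more than once during the execution of the generic algorithm on $(\Gamma,t)$; otherwise it is non-redundant. Standing assumption: every state except possibly the sink is reachable, i.e. is the current state at some iteration for some text. **Standard machines.** $R_n$ is the set of partial functions from $\{0,\dots,n\}$ to $\mathcal{A}$, seen as sets of pairs; for $H\in R_n$, $\mathbf f(H)$ is its domain and, for $k\ge0$,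 the $k$-shifted of $H$ is $\{(u-k,y): (u,y)\in H,\ u\ge k\}$. The full memory expansion $\widehat\Gamma$ of $\Gamma$ is the $w$-matching machine with states $(q,H)\in Q\times R_{O_\Gamma}$ (together with a sink), initial state $(o,\emptyset)$, pre-match states $F\times R_{O_\Gamma}$, next position to check $\alpha(q)$ and shift $\gamma(q,x)$ at $(q,H)$, and transition on $x$ from $(q,H)$: to $(\delta(q,x),H')$, with $H'$ the $\gamma(q,x)$-shifted of $H\cup\{(\alpha(q),x)\}$, if $\alpha(q)\notin\mathbf f(H)$ or $(\alpha(q),x)\in H$; to the sink if $(\alpha(q),a)\in H$ for some $a\ne x$; its unreachable states other than the sink are then removed. $\Gamma$ is *standard* if its set of states has the same cardinality as that of $\widehat\Gamma$ or, equivalently, if each state $q$ of $\Gamma$ appears in a unique state $(q,H)$ of $\widehat\Gamma$ (the sinks being set apart). **Models.** An iid model is a probability distribution $\pi$ on $\mathcal{A}$; under it a text $t$ has probability $\prod_{i=0}^{|t|-1}\pi(t_i)$. A Markov model $(\pi_M,\delta_M)$ on $Q$ consists of an initial distribution $\pi_M$ on $Q$ and transition probabilities $\delta_M(q,q')$; under it a sequence $u_0\dots u_m$ has probability $\pi_M(u_0)\prod_{i=1}^{m}\delta_M(u_{i-1},u_i)$.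
   Formalization: For standard Γ, it is also assumed that δ(q,x)=⊙ whenever x contradicts the memory H of q in the full memory expansion; the standard formula is asserted only for q'≠⊙ and nonzero denominator, since it otherwise fails or is undefined. *)

theory Defs
  imports "HOL-Probability.Probability"
begin

section \<open>Matching machines\<close>

record ('s, 'a) machine =
  mstates :: "'s set"
  minit :: 's
  mprematch :: "'s set"
  mpos :: "'s \<Rightarrow> nat"
  mtrans :: "'s \<Rightarrow> 'a \<Rightarrow> 's"
  mshift :: "'s \<Rightarrow> 'a \<Rightarrow> nat"
  msink :: 's

definition machine_order :: "('s, 'a) machine \<Rightarrow> nat" where
  "machine_order \<Gamma> = Max (mpos \<Gamma> ` mstates \<Gamma>)"

section \<open>The generic algorithm\<close>

text \<open>
  \<open>config \<Gamma> t i\<close> is the pair (current state, current position) at the beginning of iteration \<open>i\<close>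
  (iterations are numbered from 0).  It is meaningful only if \<open>executes w \<Gamma> t i\<close>, i.e. if the
  iterations \<open>0, \<dots>, i\<close> really take place.  Reporting occurrences, the only use of the pre-match
  states, does not influence the run and is not modelled.

  Outside the pre-match states the position to check may lie beyond the end of the text although
  the loop test \<open>p \<le> |t| - |w|\<close> succeeds.  There is then no symbol to read and the run stops.
\<close>

primrec config :: "('s, 'a) machine \<Rightarrow> 'a list \<Rightarrow> nat \<Rightarrow> 's \<times> nat" where
  "config \<Gamma> t 0 = (minit \<Gamma>, 0)"
| "config \<Gamma> t (Suc i) =
     (let (q, p) = config \<Gamma> t i; x = t ! (p + mpos \<Gamma> q)
      in (mtrans \<Gamma> q x, p + mshift \<Gamma> q x))"

definition accessed :: "('s, 'a) machine \<Rightarrow> 'a list \<Rightarrow> nat \<Rightarrow> nat" where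
  "accessed \<Gamma> t i = (let (q, p) = config \<Gamma> t i in p + mpos \<Gamma> q)"

definition executes :: "'a list \<Rightarrow> ('s, 'a) machine \<Rightarrow> 'a list \<Rightarrow> nat \<Rightarrow> bool" where
  "executes w \<Gamma> t i \<longleftrightarrow>
     (\<forall>j\<le>i. snd (config \<Gamma> t j) + length w \<le> length t \<and> accessed \<Gamma> t j < length t)"

definition parsed :: "('s, 'a) machine \<Rightarrow> 'a list \<Rightarrow> nat \<Rightarrow> 's list" where
  "parsed \<Gamma> t k = map (\<lambda>i. fst (config \<Gamma> t i)) [0..<k]"

definition reachable :: "'a list \<Rightarrow> ('s, 'a) machine \<Rightarrow> 's \<Rightarrow> bool" where
  "reachable w \<Gamma> q \<longleftrightarrow> (\<exists>t i. executes w \<Gamma> t i \<and> fst (config \<Gamma> t i) = q)"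

definition redundant :: "'a list \<Rightarrow> ('s, 'a) machine \<Rightarrow> bool" where
  "redundant w \<Gamma> \<longleftrightarrow>
     (\<exists>t i j. i < j \<and> executes w \<Gamma> t j \<and> accessed \<Gamma> t i = accessed \<Gamma> t j)"

text \<open>The last clause is the standing assumption that only the sink may be unreachable.\<close>

definition matching_machine :: "'a list \<Rightarrow> ('s, 'a) machine \<Rightarrow> bool" where
  "matching_machine w \<Gamma> \<longleftrightarrow>
     finite (mstates \<Gamma>) \<and> minit \<Gamma> \<in> mstates \<Gamma> \<and> msink \<Gamma> \<in> mstates \<Gamma> \<and>
     mprematch \<Gamma> \<subseteq> mstates \<Gamma> \<and> (\<forall>q\<in>mprematch \<Gamma>. mpos \<Gamma> q < length w) \<and>
     (\<forall>q\<in>mstates \<Gamma>. \<forall>x. mtrans \<Gamma> q x \<in> mstates \<Gamma>) \<and>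
     (\<forall>x. mtrans \<Gamma> (msink \<Gamma>) x = msink \<Gamma> \<and> mshift \<Gamma> (msink \<Gamma>) x = 0) \<and>
     (\<forall>q\<in>mstates \<Gamma> - {msink \<Gamma>}. reachable w \<Gamma> q)"

section \<open>Full memory expansion and standard machines\<close>

definition R :: "nat \<Rightarrow> (nat \<rightharpoonup> 'a) set" where
  "R n = {H. dom H \<subseteq> {..n}}"

definition shifted :: "nat \<Rightarrow> (nat \<rightharpoonup> 'a) \<Rightarrow> (nat \<rightharpoonup> 'a)" where
  "shifted k H = (\<lambda>u. H (u + k))"

text \<open>
  The sink of the expansion is the fresh element \<open>None\<close>; in particular it differs from every pair
  \<open>(msink \<Gamma>, H)\<close>.  Its position to check is irrelevant and set to 0.
\<close>

definition raw_expansion ::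
    "('s, 'a) machine \<Rightarrow> (('s \<times> (nat \<rightharpoonup> 'a)) option, 'a) machine" where
  "raw_expansion \<Gamma> =
     \<lparr> mstates = insert None (Some ` (mstates \<Gamma> \<times> R (machine_order \<Gamma>))),
       minit = Some (minit \<Gamma>, Map.empty),
       mprematch = Some ` (mprematch \<Gamma> \<times> R (machine_order \<Gamma>)),
       mpos = (\<lambda>s. case s of None \<Rightarrow> 0 | Some (q, H) \<Rightarrow> mpos \<Gamma> q),
       mtrans = (\<lambda>s x. case s of
           None \<Rightarrow> None
         | Some (q, H) \<Rightarrow>
             if mpos \<Gamma> q \<notin> dom H \<or> H (mpos \<Gamma> q) = Some x
             then Some (mtrans \<Gamma> q x, shifted (mshift \<Gamma> q x) (H(mpos \<Gamma> q \<mapsto> x)))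
             else None),
       mshift = (\<lambda>s x. case s of None \<Rightarrow> 0 | Some (q, H) \<Rightarrow> mshift \<Gamma> q x),
       msink = None \<rparr>"

definition expansion ::
    "'a list \<Rightarrow> ('s, 'a) machine \<Rightarrow> (('s \<times> (nat \<rightharpoonup> 'a)) option, 'a) machine" where
  "expansion w \<Gamma> =
     (let \<Gamma>' = raw_expansion \<Gamma>;
          S = insert None {s \<in> mstates \<Gamma>'. reachable w \<Gamma>' s}
      in \<Gamma>'\<lparr> mstates := S, mprematch := mprematch \<Gamma>' \<inter> S \<rparr>)"

text \<open>
  The sink \<open>None\<close> accounts for the sink of \<open>\<Gamma>\<close>, so equality of cardinalities means that each
  state other than the sink occurs in exactly one reachable pair, and the sink in none.
\<close>

definition standard :: "'a list \<Rightarrow> ('s, 'a) machine \<Rightarrow> bool" where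
  "standard w \<Gamma> \<longleftrightarrow> card (mstates \<Gamma>) = card (mstates (expansion w \<Gamma>))"

text \<open>
  A symbol contradicting the memory is never read, so equality of cardinalities puts no constraint
  on \<open>\<delta>(q, x)\<close> for such a symbol.  The following condition says that \<open>\<Gamma>\<close> goes to its sink
  wherever its expansion does.
\<close>

definition sink_like_expansion :: "'a list \<Rightarrow> ('s, 'a) machine \<Rightarrow> bool" where
  "sink_like_expansion w \<Gamma> \<longleftrightarrow>
     (\<forall>q H x. Some (q, H) \<in> mstates (expansion w \<Gamma>) \<and>
        mtrans (expansion w \<Gamma>) (Some (q, H)) x = msink (expansion w \<Gamma>) \<longrightarrow>
        mtrans \<Gamma> q x = msink \<Gamma>)"

section \<open>Models\<close>

text \<open>Texts of length \<open>n\<close> under the iid model \<open>\<pi>\<close> are distributed as \<open>replicate_pmf n \<pi>\<close>.\<close>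

lemma pmf_iid_text:
  "pmf (replicate_pmf n \<pi>) t = (if length t = n then \<Prod>i<length t. pmf \<pi> (t ! i) else 0)"
proof (induction n arbitrary: t)
  case 0
  then show ?case by auto
next
  case (Suc n)
  have eq: "replicate_pmf (Suc n) \<pi> =
      map_pmf (\<lambda>(x, xs). x # xs) (pair_pmf \<pi> (replicate_pmf n \<pi>))"
    by (simp add: map_pmf_def pair_pmf_def bind_assoc_pmf bind_return_pmf)
  show ?case
  proof (cases t)
    case Nil
    then show ?thesis unfolding eq by (auto simp: pmf_eq_0_set_pmf)
  next
    case (Cons x xs)
    have "inj (\<lambda>(x :: 'a, xs). x # xs)" by (auto simp: inj_def)
    from pmf_map_inj'[OF this, of "pair_pmf \<pi> (replicate_pmf n \<pi>)" "(x, xs)"]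
    have "pmf (replicate_pmf (Suc n) \<pi>) t = pmf \<pi> x * pmf (replicate_pmf n \<pi>) xs"
      unfolding eq Cons by (simp add: pmf_pair)
    then show ?thesis
      by (simp add: Suc.IH Cons prod.lessThan_Suc_shift del: prod.lessThan_Suc)
  qed
qed

definition markov_model :: "'s set \<Rightarrow> 's pmf \<Rightarrow> ('s \<Rightarrow> 's pmf) \<Rightarrow> bool" where
  "markov_model S \<pi>M \<delta>M \<longleftrightarrow> set_pmf \<pi>M \<subseteq> S \<and> (\<forall>q\<in>S. set_pmf (\<delta>M q) \<subseteq> S)"

definition markov_prob :: "'s pmf \<Rightarrow> ('s \<Rightarrow> 's pmf) \<Rightarrow> 's list \<Rightarrow> real" where
  "markov_prob \<pi>M \<delta>M u =
     pmf \<pi>M (u ! 0) * (\<Prod>i=1..length u - 1. pmf (\<delta>M (u ! (i - 1))) (u ! i))"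

text \<open>
  The number of iterations depends on the text.  That the sequence of parsed states follows a
  Markov model means: for all \<open>m\<close> and all text lengths \<open>n\<close> for which at least \<open>m + 1\<close> iterations
  take place, the first \<open>m + 1\<close> parsed states are distributed as prescribed by the model.
  By \<open>long_texts_execute\<close> below, for each \<open>m\<close> all sufficiently large \<open>n\<close> are of this kind.
\<close>

definition parsed_states_follow ::
    "'a list \<Rightarrow> ('s, 'a) machine \<Rightarrow> 'a pmf \<Rightarrow> 's pmf \<Rightarrow> ('s \<Rightarrow> 's pmf) \<Rightarrow> bool" where
  "parsed_states_follow w \<Gamma> \<pi> \<pi>M \<delta>M \<longleftrightarrow>
     (\<forall>m n u. (\<forall>t. length t = n \<longrightarrow> executes w \<Gamma> t m) \<longrightarrow>
        set u \<subseteq> mstates \<Gamma> \<longrightarrow> length u = Suc m \<longrightarrow>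
        measure_pmf.prob (replicate_pmf n \<pi>) {t. parsed \<Gamma> t (Suc m) = u} =
          markov_prob \<pi>M \<delta>M u)"

lemma long_texts_execute:
  fixes \<Gamma> :: "('s, 'a :: finite) machine"
  assumes "matching_machine w \<Gamma>"
  shows "\<exists>N. \<forall>t. length t \<ge> N \<longrightarrow> executes w \<Gamma> t m"
proof -
  define K where "K = Max ((\<lambda>(q, x). mshift \<Gamma> q x) ` (mstates \<Gamma> \<times> (UNIV :: 'a set)))"
  have fin: "finite (mstates \<Gamma>)" using assms by (simp add: matching_machine_def)
  have K: "mshift \<Gamma> q x \<le> K" if "q \<in> mstates \<Gamma>" for q x
    unfolding K_def using fin that by (intro Max_ge) force+
  have ord: "mpos \<Gamma> q \<le> machine_order \<Gamma>" if "q \<in> mstates \<Gamma>" for q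
    unfolding machine_order_def using fin that by (intro Max_ge) auto
  have inv: "fst (config \<Gamma> t i) \<in> mstates \<Gamma> \<and> snd (config \<Gamma> t i) \<le> i * K" for t i
  proof (induction i)
    case 0
    then show ?case using assms by (simp add: matching_machine_def)
  next
    case (Suc i)
    obtain q p where qp: "config \<Gamma> t i = (q, p)" by fastforce
    with Suc have "q \<in> mstates \<Gamma>" "p \<le> i * K" by auto
    moreover have "mshift \<Gamma> q (t ! (p + mpos \<Gamma> q)) \<le> K"
      using K \<open>q \<in> mstates \<Gamma>\<close> by blast
    ultimately show ?case
      using assms qp by (auto simp: matching_machine_def Let_def)
  qed
  show ?thesis
  proof (intro exI allI impI)
    fix t :: "'a list"
    assume len: "length t \<ge> m * K + length w + machine_order \<Gamma> + 1"
    show "executes w \<Gamma> t m"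
      unfolding executes_def
    proof (intro allI impI)
      fix j assume "j \<le> m"
      then have jm: "j * K \<le> m * K" by (rule mult_right_mono) simp
      obtain q p where qp: "config \<Gamma> t j = (q, p)" by fastforce
      have "q \<in> mstates \<Gamma>" "p \<le> j * K" using inv[of t j] qp by auto
      moreover have "mpos \<Gamma> q \<le> machine_order \<Gamma>" using ord \<open>q \<in> mstates \<Gamma>\<close> by blast
      ultimately have "p + length w \<le> length t" "p + mpos \<Gamma> q < length t"
        using len jm by linarith+
      then show "snd (config \<Gamma> t j) + length w \<le> length t \<and> accessed \<Gamma> t j < length t"
        using qp by (simp add: accessed_def)
    qed
  qed
qed

end

theory Submission
  imports Defs
begin

text \<open>
  The symbols read so far determine the configuration, hence the next position to check.  If that
  position is fresh, the history of the run does not depend on the symbol there, so the next symbol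
  has law \<open>\<pi>\<close>; otherwise the next symbol is already known.  The parsed states form a Markov chain as
  soon as the current state alone determines which case occurs and, in the second case, the known
  symbol.  In a non-redundant machine every position is fresh.  In a standard machine the state
  determines the memory; its sink is never reached, so \<open>\<delta>(q, x) = \<odot>\<close> exactly for the symbols \<open>x\<close>
  contradicting the memory of \<open>q\<close>, and normalising by the mass of the other symbols gives the law
  above: the mass is 1 at a fresh position, and that of the known symbol otherwise.
\<close>

section \<open>Runs of a machine\<close>

abbreviation state_at :: "('s, 'a) machine \<Rightarrow> 'a list \<Rightarrow> nat \<Rightarrow> 's" where
  "state_at \<Gamma> t i \<equiv> fst (config \<Gamma> t i)"

abbreviation symbol_read :: "('s, 'a) machine \<Rightarrow> 'a list \<Rightarrow> nat \<Rightarrow> 'a" where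
  "symbol_read \<Gamma> t i \<equiv> t ! accessed \<Gamma> t i"

definition fresh :: "('s, 'a) machine \<Rightarrow> 'a list \<Rightarrow> nat \<Rightarrow> bool" where
  "fresh \<Gamma> t i \<longleftrightarrow> (\<forall>j<i. accessed \<Gamma> t j \<noteq> accessed \<Gamma> t i)"

lemma accessed_eq: "accessed \<Gamma> t i = snd (config \<Gamma> t i) + mpos \<Gamma> (state_at \<Gamma> t i)"
  by (simp add: accessed_def split_def Let_def)

lemma config_Suc:
  "config \<Gamma> t (Suc i) =
     (mtrans \<Gamma> (state_at \<Gamma> t i) (symbol_read \<Gamma> t i),
      snd (config \<Gamma> t i) + mshift \<Gamma> (state_at \<Gamma> t i) (symbol_read \<Gamma> t i))"
  by (simp add: accessed_eq split_def Let_def)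

declare config.simps(2) [simp del]

text \<open>Each text is read at its own positions here: transition and shift depend only on state
  and symbol, so the word of symbols read fixes the run, wherever those symbols stand.\<close>

lemma config_cong_read:
  assumes "\<And>j. j < k \<Longrightarrow> symbol_read \<Gamma> t j = symbol_read \<Gamma> t' j"
  shows "i \<le> k \<Longrightarrow> config \<Gamma> t i = config \<Gamma> t' i"
proof (induction i)
  case (Suc i)
  then show ?case using assms[of i] by (simp add: config_Suc)
qed simp

text \<open>Here both texts are compared at the positions visited on \<open>t\<close>, so letters
  not yet visited may be changed freely.\<close>

lemma config_cong_text:
  assumes "\<And>j. j < k \<Longrightarrow> t ! accessed \<Gamma> t j = t' ! accessed \<Gamma> t j"
  shows "i \<le> k \<Longrightarrow> config \<Gamma> t i = config \<Gamma> t' i"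
proof (induction i)
  case (Suc i)
  then have "config \<Gamma> t i = config \<Gamma> t' i" by simp
  then show ?case using Suc.prems assms[of i] by (simp add: config_Suc accessed_eq)
qed simp

lemma executes_mono: "executes w \<Gamma> t i \<Longrightarrow> j \<le> i \<Longrightarrow> executes w \<Gamma> t j"
  by (auto simp: executes_def)

lemma executes_accessed_less: "executes w \<Gamma> t i \<Longrightarrow> j \<le> i \<Longrightarrow> accessed \<Gamma> t j < length t"
  by (auto simp: executes_def)

lemma config_position_mono: "i \<le> j \<Longrightarrow> snd (config \<Gamma> t i) \<le> snd (config \<Gamma> t j)"
  by (rule lift_Suc_mono_le[of "\<lambda>i. snd (config \<Gamma> t i)"]) (simp_all add: config_Suc)

lemma state_at_in_states:
  assumes "matching_machine w \<Gamma>"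
  shows "state_at \<Gamma> t i \<in> mstates \<Gamma>"
  using assms by (induction i) (auto simp: matching_machine_def config_Suc)

lemma ex_run_to_state:
  assumes "matching_machine w \<Gamma>" and "q \<in> mstates \<Gamma>" "q \<noteq> msink \<Gamma>"
  obtains t i where "executes w \<Gamma> t i" "state_at \<Gamma> t i = q"
proof -
  have "reachable w \<Gamma> q"
    using assms by (simp add: matching_machine_def)
  then show thesis using that by (auto simp: reachable_def)
qed

text \<open>Any symbol can be written at a fresh position without disturbing the past of the run;
  enough padding then makes one more iteration take place.\<close>

lemma ex_continued_run:
  fixes \<Gamma> :: "('s, 'a :: finite) machine"
  assumes "matching_machine w \<Gamma>" and ex: "executes w \<Gamma> t i"
    and x: "x = symbol_read \<Gamma> t i \<or> fresh \<Gamma> t i"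
  obtains t' where "executes w \<Gamma> t' (Suc i)" "\<And>j. j \<le> i \<Longrightarrow> config \<Gamma> t' j = config \<Gamma> t j"
    "state_at \<Gamma> t' (Suc i) = mtrans \<Gamma> (state_at \<Gamma> t i) x"
proof -
  obtain N where N: "\<And>t. length t \<ge> N \<Longrightarrow> executes w \<Gamma> t (Suc i)"
    using long_texts_execute[OF assms(1)] by blast
  define t' where "t' = t[accessed \<Gamma> t i := x] @ replicate N x"
  \<comment> \<open>The only overwritten position either was not visited before iteration
    \<open>i\<close> or already carried \<open>x\<close>.\<close>
  have "t ! accessed \<Gamma> t j = t' ! accessed \<Gamma> t j" if "j < i" for j
    using x executes_accessed_less[OF ex, of j] executes_accessed_less[OF ex, of i] that
    by (auto simp: t'_def nth_append fresh_def nth_list_update)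
  then have same: "config \<Gamma> t' j = config \<Gamma> t j" if "j \<le> i" for j
    using config_cong_text[of i t \<Gamma> t' j] that by simp
  then have "accessed \<Gamma> t' i = accessed \<Gamma> t i"
    by (simp add: accessed_eq)
  then have "symbol_read \<Gamma> t' i = x"
    using executes_accessed_less[OF ex, of i] by (simp add: t'_def nth_append)
  then have "state_at \<Gamma> t' (Suc i) = mtrans \<Gamma> (state_at \<Gamma> t i) x"
    by (simp add: config_Suc same)
  moreover have "executes w \<Gamma> t' (Suc i)"
    by (rule N) (simp add: t'_def)
  ultimately show thesis using that same by blast
qed

section \<open>The law of the parsed states\<close>

lemma prob_split_values:
  assumes "finite X"
  shows "measure_pmf.prob p {t. P t \<and> f t \<in> X} = (\<Sum>x\<in>X. measure_pmf.prob p {t. P t \<and> f t = x})"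
proof -
  have "{t. P t \<and> f t \<in> X} = (\<Union>x\<in>X. {t. P t \<and> f t = x})" by auto
  then show ?thesis
    using assms
    by (simp add: measure_pmf.finite_measure_finite_Union disjoint_family_on_def disjoint_iff)
qed

lemma pmf_map_finite:
  fixes p :: "'a :: finite pmf"
  shows "pmf (map_pmf f p) y = (\<Sum>x | f x = y. pmf p x)"
  by (simp add: pmf_map vimage_def measure_measure_pmf_finite)

text \<open>Independence of the letters in the form of a coupling: one letter may be redrawn without
  changing the law.\<close>

lemma replicate_pmf_resample:
  assumes "i < n"
  shows "map_pmf (\<lambda>(t, y). t[i := y]) (pair_pmf (replicate_pmf n \<pi>) \<pi>) = replicate_pmf n \<pi>"
  using assms
proof (induction n arbitrary: i)
  case (Suc n)
  show ?case
  proof (cases i)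
    case 0
    then show ?thesis
      by (simp add: map_pmf_def pair_pmf_def bind_assoc_pmf bind_return_pmf)
        \<comment> \<open>The old first letter has disappeared as a constant bind; it remains to
          draw the new one before the tail.\<close>
        (subst bind_commute_pmf, simp)
  next
    case (Suc j)
    then have IH: "map_pmf (\<lambda>(t, y). t[j := y]) (pair_pmf (replicate_pmf n \<pi>) \<pi>) = replicate_pmf n \<pi>"
      using Suc.IH Suc.prems by simp
    have "map_pmf (\<lambda>(t, y). t[i := y]) (pair_pmf (replicate_pmf (Suc n) \<pi>) \<pi>) =
        bind_pmf \<pi> (\<lambda>x. map_pmf ((#) x)
          (map_pmf (\<lambda>(t, y). t[j := y]) (pair_pmf (replicate_pmf n \<pi>) \<pi>)))"
      by (simp add: Suc map_pmf_def pair_pmf_def bind_assoc_pmf bind_return_pmf)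
    also have "\<dots> = replicate_pmf (Suc n) \<pi>"
      unfolding IH by (simp add: map_pmf_def)
    finally show ?thesis .
  qed
qed simp

lemma prob_replicate_pmf_nth_indep:
  fixes \<pi> :: "'a :: finite pmf"
  assumes "i < n" and inv: "\<And>t y. length t = n \<Longrightarrow> t[i := y] \<in> A \<longleftrightarrow> t \<in> A"
  shows "measure_pmf.prob (replicate_pmf n \<pi>) {t. t \<in> A \<and> t ! i = x} =
    measure_pmf.prob (replicate_pmf n \<pi>) A * pmf \<pi> x"
proof -
  let ?T = "replicate_pmf n \<pi>"
  have "measure_pmf.prob ?T {t. t \<in> A \<and> t ! i = x} =
      measure_pmf.prob (pair_pmf ?T \<pi>) ((\<lambda>(t, y). t[i := y]) -` {t. t \<in> A \<and> t ! i = x})"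
    by (subst replicate_pmf_resample[OF assms(1), symmetric]) simp
  \<comment> \<open>For the redrawn text, membership in \<open>A\<close> depends on \<open>t\<close>
    alone and letter \<open>i\<close> is \<open>y\<close>. Both use that texts in the support have
    length \<open>n\<close>.\<close>
  also have "\<dots> = measure_pmf.prob (pair_pmf ?T \<pi>) (A \<times> {x})"
    using assms by (intro measure_pmf.finite_measure_eq_AE) (auto simp: AE_measure_pmf_iff set_replicate_pmf)
  also have "\<dots> = measure_pmf.prob ?T A * pmf \<pi> x"
    by (subst measure_pmf_prob_product) (auto simp: measure_pmf_single)
  finally show ?thesis .
qed

text \<open>\<open>D q\<close> is the law of the symbol read in state \<open>q\<close>, conditionally on the symbols read before.\<close>

definition reading_law ::
    "'a list \<Rightarrow> ('s, 'a) machine \<Rightarrow> 'a pmf \<Rightarrow> ('s \<Rightarrow> 'a pmf) \<Rightarrow> bool" where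
  "reading_law w \<Gamma> \<pi> D \<longleftrightarrow> (\<forall>t i. executes w \<Gamma> t i \<longrightarrow>
     D (state_at \<Gamma> t i) = (if fresh \<Gamma> t i then \<pi> else return_pmf (symbol_read \<Gamma> t i)))"

text \<open>On \<open>E\<close> the next position is the same for all texts. If it is fresh,
  rewriting it preserves \<open>E\<close>, and independence applies; if not, \<open>E\<close> has
  already fixed the letter there.\<close>

lemma prob_next_symbol_given_history:
  fixes \<Gamma> :: "('s, 'a :: finite) machine"
  assumes D: "reading_law w \<Gamma> \<pi> D"
    and ex: "executes w \<Gamma> t0 k" and len: "length t0 = n"
    and E: "E = {t. length t = n \<and> (\<forall>j<k. symbol_read \<Gamma> t j = symbol_read \<Gamma> t0 j)}"
  shows "measure_pmf.prob (replicate_pmf n \<pi>) {t. t \<in> E \<and> symbol_read \<Gamma> t k = x} =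
    measure_pmf.prob (replicate_pmf n \<pi>) E * pmf (D (state_at \<Gamma> t0 k)) x"
proof -
  have same: "accessed \<Gamma> t j = accessed \<Gamma> t0 j" if "t \<in> E" "j \<le> k" for t j
    using config_cong_read[of k t \<Gamma> t0 j] that by (simp add: E accessed_eq)
  have eq: "{t. t \<in> E \<and> symbol_read \<Gamma> t k = x} = {t. t \<in> E \<and> t ! accessed \<Gamma> t0 k = x}"
    using same by auto
  show ?thesis
  proof (cases "fresh \<Gamma> t0 k")
    case True
    have upd: "t[accessed \<Gamma> t0 k := y] \<in> E" if "t \<in> E" for t y
    proof -
      let ?t = "t[accessed \<Gamma> t0 k := y]"
      have agree: "t ! accessed \<Gamma> t j = ?t ! accessed \<Gamma> t j" if "j < k" for j
        using True that same[OF \<open>t \<in> E\<close>, of j] by (metis fresh_def less_imp_le nth_list_update_neq)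
      then have "config \<Gamma> t j = config \<Gamma> ?t j" if "j \<le> k" for j
        using config_cong_text[of k t \<Gamma> ?t j] that by blast
      then have "symbol_read \<Gamma> ?t j = symbol_read \<Gamma> t j" if "j < k" for j
        using agree[OF that] that by (simp add: accessed_eq)
      then show ?thesis using \<open>t \<in> E\<close> by (simp add: E)
    qed
    \<comment> \<open>The converse restores the original letter by a second update.\<close>
    have "t[accessed \<Gamma> t0 k := y] \<in> E \<longleftrightarrow> t \<in> E" for t y
      using upd[of t y] upd[of "t[accessed \<Gamma> t0 k := y]" "t ! accessed \<Gamma> t0 k"] by auto
    moreover have "accessed \<Gamma> t0 k < n"
      using executes_accessed_less[OF ex] len by simp
    ultimately show ?thesis
      using D ex True unfolding eq
      by (simp add: prob_replicate_pmf_nth_indep reading_law_def)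
  next
    case False
    then obtain j where j: "j < k" "accessed \<Gamma> t0 j = accessed \<Gamma> t0 k"
      by (auto simp: fresh_def)
    \<comment> \<open>Iteration \<open>j\<close> on \<open>t\<close> visited this same position, and
      \<open>E\<close> prescribes what it read.\<close>
    have "t ! accessed \<Gamma> t0 k = symbol_read \<Gamma> t0 k" if "t \<in> E" for t
      using that j same[of t j] by (simp add: E) metis
    then have "{t. t \<in> E \<and> t ! accessed \<Gamma> t0 k = x} = (if x = symbol_read \<Gamma> t0 k then E else {})"
      by auto
    moreover have "D (state_at \<Gamma> t0 k) = return_pmf (symbol_read \<Gamma> t0 k)"
      using D ex False by (auto simp: reading_law_def)
    ultimately show ?thesis
      unfolding eq by (simp add: pmf_return)
  qed
qed

text \<open>The Markov property: the law of the next symbol given a history depends only on the last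
  state, so it is common to all histories leading to \<open>v\<close> and factors out of the sum
  over them.\<close>

lemma prob_next_symbol:
  fixes \<Gamma> :: "('s, 'a :: finite) machine"
  assumes D: "reading_law w \<Gamma> \<pi> D"
    and ex: "\<And>t. length t = n \<Longrightarrow> executes w \<Gamma> t k"
    and len: "length v = Suc k"
  shows "measure_pmf.prob (replicate_pmf n \<pi>)
      {t. (length t = n \<and> parsed \<Gamma> t (Suc k) = v) \<and> symbol_read \<Gamma> t k = x} =
    measure_pmf.prob (replicate_pmf n \<pi>) {t. length t = n \<and> parsed \<Gamma> t (Suc k) = v} *
      pmf (D (last v)) x"
proof -
  let ?pr = "measure_pmf.prob (replicate_pmf n \<pi>)"
  let ?A = "{t. length t = n \<and> parsed \<Gamma> t (Suc k) = v}"
  define hist where "hist t = map (\<lambda>j. symbol_read \<Gamma> t j) [0..<k]" for t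
  define Hs where "Hs = {h :: 'a list. length h = k}"
  have fin: "finite Hs"
    using finite_lists_length_eq[of "UNIV :: 'a set" k] by (simp add: Hs_def)
  have hist: "hist t \<in> Hs" for t by (simp add: hist_def Hs_def)
  have "?pr {t. (t \<in> ?A \<and> symbol_read \<Gamma> t k = x) \<and> hist t = h} =
      ?pr {t. t \<in> ?A \<and> hist t = h} * pmf (D (last v)) x" for h
  proof (cases "\<exists>t0. t0 \<in> ?A \<and> hist t0 = h")
    case True
    then obtain t0 where t0: "length t0 = n" "parsed \<Gamma> t0 (Suc k) = v" "hist t0 = h" by blast
    define E where "E = {t. length t = n \<and> (\<forall>j<k. symbol_read \<Gamma> t j = symbol_read \<Gamma> t0 j)}"
    \<comment> \<open>Symbols read determine states, so one text of \<open>?A\<close> with this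
      history brings in all texts of length \<open>n\<close> having it.\<close>
    have "parsed \<Gamma> t (Suc k) = v" if "t \<in> E" for t
      using config_cong_read[of k t \<Gamma> t0] that t0(2) by (auto simp: parsed_def E_def)
    moreover have "hist t = h \<longleftrightarrow> (\<forall>j<k. symbol_read \<Gamma> t j = symbol_read \<Gamma> t0 j)" for t
      by (auto simp: t0(3)[symmetric] hist_def)
    ultimately have E: "{t. t \<in> ?A \<and> hist t = h} = E"
      unfolding E_def by blast
    have "last v = state_at \<Gamma> t0 k"
      using t0(2) by (auto simp: parsed_def)
    moreover have "{t. (t \<in> ?A \<and> symbol_read \<Gamma> t k = x) \<and> hist t = h} =
        {t. t \<in> E \<and> symbol_read \<Gamma> t k = x}"
      using E by blast
    ultimately show ?thesis
      using prob_next_symbol_given_history[OF D ex[OF t0(1)] t0(1) E_def] E by simp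
  next
    case False
    then have "{t. t \<in> ?A \<and> hist t = h} = {}"
      and "{t. (t \<in> ?A \<and> symbol_read \<Gamma> t k = x) \<and> hist t = h} = {}" by blast+
    then show ?thesis by (simp only: measure_empty mult_zero_left)
  qed
  then show ?thesis
    using prob_split_values[OF fin, of "replicate_pmf n \<pi>" "\<lambda>t. t \<in> ?A \<and> symbol_read \<Gamma> t k = x" hist]
      prob_split_values[OF fin, of "replicate_pmf n \<pi>" "\<lambda>t. t \<in> ?A" hist]
    by (simp add: hist sum_distrib_right)
qed

lemma markov_prob_snoc:
  assumes "v \<noteq> []"
  shows "markov_prob p d (v @ [q]) = markov_prob p d v * pmf (d (last v)) q"
proof -
  obtain k where k: "length v = Suc k" using assms by (cases v) auto
  have "(\<Prod>i=1..k. pmf (d ((v @ [q]) ! (i - 1))) ((v @ [q]) ! i)) =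
      (\<Prod>i=1..k. pmf (d (v ! (i - 1))) (v ! i))"
    using k by (intro prod.cong) (auto simp: nth_append)
  moreover have "(v @ [q]) ! 0 = v ! 0" "(v @ [q]) ! k = last v" "(v @ [q]) ! Suc k = q"
    using k assms by (simp_all add: nth_append last_conv_nth)
  ultimately show ?thesis
    using k by (simp add: markov_prob_def)
qed

text \<open>Induction on the number of states: the next state is the image of the symbol just read,
  whence the push-forward \<open>d\<close> of its law.\<close>

lemma prob_parsed_eq_markov_prob:
  fixes \<Gamma> :: "('s, 'a :: finite) machine"
  assumes D: "reading_law w \<Gamma> \<pi> D"
  defines "d \<equiv> \<lambda>q. map_pmf (mtrans \<Gamma> q) (D q)"
  shows "(\<And>t. length t = n \<Longrightarrow> executes w \<Gamma> t m) \<Longrightarrow> length u = Suc m \<Longrightarrow>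
    measure_pmf.prob (replicate_pmf n \<pi>) {t. length t = n \<and> parsed \<Gamma> t (Suc m) = u} =
    markov_prob (return_pmf (minit \<Gamma>)) d u"
proof (induction m arbitrary: u)
  case 0
  then obtain q where u: "u = [q]" by (auto simp: length_Suc_conv)
  have "measure_pmf.prob (replicate_pmf n \<pi>) {t. length t = n \<and> parsed \<Gamma> t (Suc 0) = u} =
      measure_pmf.prob (replicate_pmf n \<pi>) (if q = minit \<Gamma> then UNIV else {})"
    by (intro measure_pmf.finite_measure_eq_AE)
      (auto simp: AE_measure_pmf_iff set_replicate_pmf u parsed_def)
  then show ?case by (simp add: u markov_prob_def pmf_return)
next
  case (Suc m)
  let ?pr = "measure_pmf.prob (replicate_pmf n \<pi>)"
  obtain v q where u: "u = v @ [q]" and v: "length v = Suc m"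
    using Suc.prems(2) by (cases u rule: rev_cases) auto
  have ex: "executes w \<Gamma> t m" if "length t = n" for t
    using Suc.prems(1)[OF that] executes_mono by (metis le_SucI order_refl)
  have "parsed \<Gamma> t (Suc (Suc m)) = u \<longleftrightarrow>
      parsed \<Gamma> t (Suc m) = v \<and> symbol_read \<Gamma> t m \<in> {x. mtrans \<Gamma> (last v) x = q}" for t
    by (auto simp: parsed_def u config_Suc)
  then have "?pr {t. length t = n \<and> parsed \<Gamma> t (Suc (Suc m)) = u} =
      ?pr {t. (length t = n \<and> parsed \<Gamma> t (Suc m) = v) \<and>
        symbol_read \<Gamma> t m \<in> {x. mtrans \<Gamma> (last v) x = q}}"
    by (simp add: conj_assoc)
  also have "\<dots> = (\<Sum>x | mtrans \<Gamma> (last v) x = q.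
      ?pr {t. (length t = n \<and> parsed \<Gamma> t (Suc m) = v) \<and> symbol_read \<Gamma> t m = x})"
    by (rule prob_split_values) simp
  also have "\<dots> = ?pr {t. length t = n \<and> parsed \<Gamma> t (Suc m) = v} * pmf (d (last v)) q"
    by (simp only: prob_next_symbol[OF D ex v] d_def pmf_map_finite sum_distrib_left)
  also have "\<dots> = markov_prob (return_pmf (minit \<Gamma>)) d u"
    unfolding u using v by (subst markov_prob_snoc) (auto simp: Suc.IH[OF ex v])
  finally show ?case .
qed

lemma parsed_states_follow_reading_law:
  fixes \<Gamma> :: "('s, 'a :: finite) machine"
  assumes D: "reading_law w \<Gamma> \<pi> D"
  shows "parsed_states_follow w \<Gamma> \<pi> (return_pmf (minit \<Gamma>)) (\<lambda>q. map_pmf (mtrans \<Gamma> q) (D q))"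
proof -
  have "measure_pmf.prob (replicate_pmf n \<pi>) {t. parsed \<Gamma> t m = u} =
      measure_pmf.prob (replicate_pmf n \<pi>) {t. length t = n \<and> parsed \<Gamma> t m = u}" for n m u
    by (intro measure_pmf.finite_measure_eq_AE) (auto simp: AE_measure_pmf_iff set_replicate_pmf)
  then show ?thesis
    unfolding parsed_states_follow_def using prob_parsed_eq_markov_prob[OF D] by simp
qed

section \<open>Non-redundant machines\<close>

lemma nonredundant_fresh: "\<not> redundant w \<Gamma> \<Longrightarrow> executes w \<Gamma> t i \<Longrightarrow> fresh \<Gamma> t i"
  by (auto simp: redundant_def fresh_def)

text \<open>Since fresh positions may carry any symbol, an \<open>x\<close> leading to the sink
  would bring some run there. The sink is absorbing with shift 0, so the next iteration would access
  the same position again.\<close>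

lemma nonredundant_avoids_sink:
  fixes \<Gamma> :: "('s, 'a :: finite) machine"
  assumes m: "matching_machine w \<Gamma>" and nr: "\<not> redundant w \<Gamma>"
    and q: "q \<in> mstates \<Gamma> - {msink \<Gamma>}"
  shows "mtrans \<Gamma> q x \<noteq> msink \<Gamma>"
proof
  assume sink: "mtrans \<Gamma> q x = msink \<Gamma>"
  obtain t i where t: "executes w \<Gamma> t i" "state_at \<Gamma> t i = q"
    using ex_run_to_state[OF m, of q] q by blast
  obtain t' where t': "executes w \<Gamma> t' (Suc i)" "state_at \<Gamma> t' (Suc i) = msink \<Gamma>"
    using ex_continued_run[OF m t(1) disjI2[OF nonredundant_fresh[OF nr t(1)]], of x] t(2) sink
    by metis
  \<comment> \<open>The symbol is kept as it stands: this extension only makes room for a second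
    iteration in the sink.\<close>
  obtain t'' where t'': "executes w \<Gamma> t'' (Suc (Suc i))" "config \<Gamma> t'' (Suc i) = config \<Gamma> t' (Suc i)"
    using ex_continued_run[OF m t'(1) disjI1[OF refl]] by blast
  then have "accessed \<Gamma> t'' (Suc (Suc i)) = accessed \<Gamma> t'' (Suc i)"
    using m t'(2) by (simp add: accessed_eq config_Suc[of _ _ "Suc i"] matching_machine_def)
  then show False
    using nonredundant_fresh[OF nr t''(1)] unfolding fresh_def by (metis lessI)
qed

section \<open>Standard machines\<close>

text \<open>Read off the run directly, with offsets relative to the current position;
  \<open>memory_Suc\<close> recovers the recursion of the expansion.\<close>

definition memory :: "('s, 'a) machine \<Rightarrow> 'a list \<Rightarrow> nat \<Rightarrow> (nat \<rightharpoonup> 'a)" where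
  "memory \<Gamma> t i = (\<lambda>u. let k = snd (config \<Gamma> t i) + u
     in if \<exists>j<i. accessed \<Gamma> t j = k then Some (t ! k) else None)"

text \<open>By \<open>mstates_expansion\<close>, these are the states of the expansion other than
  its sink \<open>None\<close>.\<close>

definition remembering_states :: "'a list \<Rightarrow> ('s, 'a) machine \<Rightarrow> ('s \<times> (nat \<rightharpoonup> 'a)) set" where
  "remembering_states w \<Gamma> = {(state_at \<Gamma> t i, memory \<Gamma> t i) | t i. executes w \<Gamma> t i}"

text \<open>Links freshness, on which the law of the next symbol depends, to the memory stored in
  the expansion.\<close>

lemma memory_mpos:
  "memory \<Gamma> t i (mpos \<Gamma> (state_at \<Gamma> t i)) =
     (if fresh \<Gamma> t i then None else Some (symbol_read \<Gamma> t i))"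
  by (auto simp: memory_def fresh_def accessed_eq Let_def)

text \<open>After a shift by \<open>s\<close>, offset \<open>u\<close> denotes the position formerly
  at offset \<open>u + s\<close>; offsets below \<open>s\<close> fall behind the current position
  and are forgotten.\<close>

lemma memory_Suc:
  "memory \<Gamma> t (Suc i) = shifted (mshift \<Gamma> (state_at \<Gamma> t i) (symbol_read \<Gamma> t i))
     ((memory \<Gamma> t i)(mpos \<Gamma> (state_at \<Gamma> t i) \<mapsto> symbol_read \<Gamma> t i))"
proof
  fix u
  define s where "s = mshift \<Gamma> (state_at \<Gamma> t i) (symbol_read \<Gamma> t i)"
  have "accessed \<Gamma> t i = snd (config \<Gamma> t i) + (u + s) \<longleftrightarrow> u + s = mpos \<Gamma> (state_at \<Gamma> t i)"
    by (auto simp: accessed_eq)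
  moreover have "snd (config \<Gamma> t (Suc i)) + u = snd (config \<Gamma> t i) + (u + s)"
    by (simp add: config_Suc s_def)
  ultimately show "memory \<Gamma> t (Suc i) u =
      shifted (mshift \<Gamma> (state_at \<Gamma> t i) (symbol_read \<Gamma> t i))
        ((memory \<Gamma> t i)(mpos \<Gamma> (state_at \<Gamma> t i) \<mapsto> symbol_read \<Gamma> t i)) u"
    unfolding s_def[symmetric] by (simp add: memory_def shifted_def Let_def less_Suc_eq ex_disj_distrib conj_disj_distribR accessed_eq[of _ _ i]
      add.assoc add.commute[of s u]) blast
qed

text \<open>The memory records the text itself, so no symbol read contradicts it and the run never
  enters \<open>None\<close>.\<close>

lemma config_raw_expansion:
  "config (raw_expansion \<Gamma>) t i =
     (Some (state_at \<Gamma> t i, memory \<Gamma> t i), snd (config \<Gamma> t i))"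
proof (induction i)
  case 0
  then show ?case by (simp add: raw_expansion_def memory_def)
next
  case (Suc i)
  have "accessed (raw_expansion \<Gamma>) t i = accessed \<Gamma> t i"
    by (simp add: accessed_eq Suc) (simp add: raw_expansion_def)
  with Suc show ?case
    by (auto simp: config_Suc memory_Suc raw_expansion_def memory_mpos domIff split: if_splits)
qed

lemma executes_raw_expansion: "executes w (raw_expansion \<Gamma>) t i \<longleftrightarrow> executes w \<Gamma> t i"
proof -
  have "mpos (raw_expansion \<Gamma>) (Some (q, H)) = mpos \<Gamma> q" for q H
    by (simp add: raw_expansion_def)
  then show ?thesis by (simp add: executes_def accessed_eq config_raw_expansion)
qed

text \<open>Positions never decrease, so the offset of a remembered letter is at most
  \<open>mpos\<close> of the state that read it.\<close>

lemma memory_in_R: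
  assumes "matching_machine w \<Gamma>"
  shows "memory \<Gamma> t i \<in> R (machine_order \<Gamma>)"
proof -
  have "u \<le> machine_order \<Gamma>" if "j < i" "accessed \<Gamma> t j = snd (config \<Gamma> t i) + u" for u j
  proof -
    have "u \<le> mpos \<Gamma> (state_at \<Gamma> t j)"
      using that config_position_mono[of j i \<Gamma> t] by (simp add: accessed_eq)
    also have "\<dots> \<le> machine_order \<Gamma>"
      using assms state_at_in_states[OF assms, of t j]
      by (auto simp: machine_order_def matching_machine_def)
    finally show ?thesis .
  qed
  then show ?thesis
    by (auto simp: R_def memory_def Let_def split: if_splits)
qed

lemma mstates_expansion:
  assumes "matching_machine w \<Gamma>"
  shows "mstates (expansion w \<Gamma>) = insert None (Some ` remembering_states w \<Gamma>)"
proof -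
  have "reachable w (raw_expansion \<Gamma>) s \<longleftrightarrow> s \<in> Some ` remembering_states w \<Gamma>" for s
    by (auto simp: reachable_def executes_raw_expansion config_raw_expansion remembering_states_def)
  moreover have "Some ` remembering_states w \<Gamma> \<subseteq> mstates (raw_expansion \<Gamma>)"
    using memory_in_R[OF assms] state_at_in_states[OF assms]
    by (auto simp: remembering_states_def raw_expansion_def)
  ultimately show ?thesis
    by (auto simp: expansion_def Let_def)
qed

section \<open>Counting the states of a standard machine\<close>

lemma finite_R: "finite (R n :: (nat \<rightharpoonup> 'a :: finite) set)"
proof -
  have "R n = (\<Union>B\<in>Pow {..n}. {H :: nat \<rightharpoonup> 'a. dom H = B \<and> ran H \<subseteq> UNIV})"
    by (auto simp: R_def)
  moreover have "finite {H :: nat \<rightharpoonup> 'a. dom H = B \<and> ran H \<subseteq> UNIV}" if "B \<in> Pow {..n}" for B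
    using that by (intro finite_set_of_finite_maps) (auto intro: finite_subset)
  ultimately show ?thesis by simp
qed

text \<open>
  In particular the sink of a standard machine is never reached: the sink of the expansion is
  counted separately, and there is no state left to be paired with the sink of the machine.
\<close>

lemma standard_remembering_states:
  fixes \<Gamma> :: "('s, 'a :: finite) machine"
  assumes m: "matching_machine w \<Gamma>" and st: "standard w \<Gamma>"
  shows "inj_on fst (remembering_states w \<Gamma>)"
    and "fst ` remembering_states w \<Gamma> = mstates \<Gamma> - {msink \<Gamma>}"
proof -
  let ?P = "remembering_states w \<Gamma>" and ?S = "mstates \<Gamma> - {msink \<Gamma>}"
  have fin: "finite (mstates \<Gamma>)" "msink \<Gamma> \<in> mstates \<Gamma>"
    using m by (auto simp: matching_machine_def)
  have "?P \<subseteq> mstates \<Gamma> \<times> R (machine_order \<Gamma>)"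
    using memory_in_R[OF m] state_at_in_states[OF m] by (auto simp: remembering_states_def)
  then have finP: "finite ?P"
    using fin(1) finite_R by (meson finite_SigmaI finite_subset)
  \<comment> \<open>The \<open>Suc\<close> counts \<open>None\<close>; removing the sink of
    \<open>\<Gamma>\<close> from the other side balances it.\<close>
  have "card (mstates \<Gamma>) = Suc (card ?P)"
    using st finP by (simp add: standard_def mstates_expansion[OF m] card_image)
  then have card: "card ?P = card ?S"
    using fin by simp
  have sub: "?S \<subseteq> fst ` ?P"
  proof
    fix q assume "q \<in> ?S"
    then obtain t i where "executes w \<Gamma> t i" "state_at \<Gamma> t i = q"
      using ex_run_to_state[OF m, of q] by blast
    then show "q \<in> fst ` ?P"
      by (intro image_eqI[of _ _ "(q, memory \<Gamma> t i)"]) (auto simp: remembering_states_def)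
  qed
  \<comment> \<open>The cardinality of the image of \<open>?P\<close> is squeezed between those of
    \<open>?S\<close> and \<open>?P\<close>, which agree; one equality yields the image, the other
    injectivity.\<close>
  have "card ?S \<le> card (fst ` ?P)"
    using sub finP by (intro card_mono) auto
  with card_image_le[OF finP, of fst] card have eq: "card (fst ` ?P) = card ?P" "card ?S = card (fst ` ?P)"
    by simp_all
  show "inj_on fst ?P" using eq_card_imp_inj_on[OF finP eq(1)] .
  show "fst ` ?P = ?S" using card_subset_eq[OF _ sub eq(2)] finP by simp
qed

lemma standard_never_in_sink:
  fixes \<Gamma> :: "('s, 'a :: finite) machine"
  assumes "matching_machine w \<Gamma>" "standard w \<Gamma>" "executes w \<Gamma> t i"
  shows "state_at \<Gamma> t i \<noteq> msink \<Gamma>"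
proof -
  have "state_at \<Gamma> t i \<in> fst ` remembering_states w \<Gamma>"
    using assms(3) by (force simp: remembering_states_def)
  then show ?thesis using standard_remembering_states(2)[OF assms(1,2)] by blast
qed

text \<open>In a standard machine the memory is unique at every state but the sink. At the sink the
  choice is arbitrary, yet the result is still a probability law.\<close>

definition recalled_law :: "'a list \<Rightarrow> ('s, 'a) machine \<Rightarrow> 'a pmf \<Rightarrow> 's \<Rightarrow> 'a pmf" where
  "recalled_law w \<Gamma> \<pi> q =
     (case (THE H. (q, H) \<in> remembering_states w \<Gamma>) (mpos \<Gamma> q) of
        None \<Rightarrow> \<pi> | Some a \<Rightarrow> return_pmf a)"

lemma reading_law_recalled_law:
  fixes \<Gamma> :: "('s, 'a :: finite) machine"
  assumes "matching_machine w \<Gamma>" "standard w \<Gamma>"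
  shows "reading_law w \<Gamma> \<pi> (recalled_law w \<Gamma> \<pi>)"
  unfolding reading_law_def
proof (intro allI impI)
  fix t i assume "executes w \<Gamma> t i"
  then have "(state_at \<Gamma> t i, memory \<Gamma> t i) \<in> remembering_states w \<Gamma>"
    by (auto simp: remembering_states_def)
  then have "(THE H. (state_at \<Gamma> t i, H) \<in> remembering_states w \<Gamma>) = memory \<Gamma> t i"
    using inj_onD[OF standard_remembering_states(1)[OF assms]] by (intro the_equality) force+
  then show "recalled_law w \<Gamma> \<pi> (state_at \<Gamma> t i) =
      (if fresh \<Gamma> t i then \<pi> else return_pmf (symbol_read \<Gamma> t i))"
    by (simp add: recalled_law_def memory_mpos)
qed

section \<open>Transition probabilities of a standard machine\<close>

lemma standard_trans_neq_sink:
  fixes \<Gamma> :: "('s, 'a :: finite) machine"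
  assumes m: "matching_machine w \<Gamma>" and st: "standard w \<Gamma>" and ex: "executes w \<Gamma> t i"
    and x: "x = symbol_read \<Gamma> t i \<or> fresh \<Gamma> t i"
  shows "mtrans \<Gamma> (state_at \<Gamma> t i) x \<noteq> msink \<Gamma>"
  using ex_continued_run[OF m ex x] standard_never_in_sink[OF m st] by metis

text \<open>The memory holds the letter at a position already read; any other symbol sends the
  expansion to its sink, and \<open>sink_like_expansion\<close> transfers this to
  \<open>\<Gamma>\<close>.\<close>

lemma standard_trans_eq_sink:
  fixes \<Gamma> :: "('s, 'a :: finite) machine"
  assumes m: "matching_machine w \<Gamma>" and sk: "sink_like_expansion w \<Gamma>" and ex: "executes w \<Gamma> t i"
    and x: "x \<noteq> symbol_read \<Gamma> t i" and nf: "\<not> fresh \<Gamma> t i"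
  shows "mtrans \<Gamma> (state_at \<Gamma> t i) x = msink \<Gamma>"
proof -
  have "Some (state_at \<Gamma> t i, memory \<Gamma> t i) \<in> mstates (expansion w \<Gamma>)"
    using ex by (auto simp: mstates_expansion[OF m] remembering_states_def)
  moreover have "mtrans (expansion w \<Gamma>) (Some (state_at \<Gamma> t i, memory \<Gamma> t i)) x = msink (expansion w \<Gamma>)"
    using x nf by (auto simp: expansion_def raw_expansion_def Let_def domIff memory_mpos)
  ultimately show ?thesis using sk by (auto simp: sink_like_expansion_def)
qed

lemma sum_pmf_UNIV: "(\<Sum>x\<in>UNIV. pmf p x) = 1" for p :: "'a :: finite pmf"
  by (simp add: sum_pmf_eq_1)

lemma standard_transition_law:
  fixes \<Gamma> :: "('s, 'a :: finite) machine"
  assumes m: "matching_machine w \<Gamma>" and st: "standard w \<Gamma>" and sk: "sink_like_expansion w \<Gamma>"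
    and q: "q \<in> mstates \<Gamma>" and q': "q' \<noteq> msink \<Gamma>"
    and nz: "(\<Sum>x | mtrans \<Gamma> q x \<noteq> msink \<Gamma>. pmf \<pi> x) \<noteq> 0"
  shows "pmf (map_pmf (mtrans \<Gamma> q) (recalled_law w \<Gamma> \<pi> q)) q' =
    (\<Sum>x | mtrans \<Gamma> q x = q'. pmf \<pi> x) / (\<Sum>x | mtrans \<Gamma> q x \<noteq> msink \<Gamma>. pmf \<pi> x)"
proof -
  \<comment> \<open>At the sink the denominator would be an empty sum.\<close>
  have "q \<noteq> msink \<Gamma>"
    using nz m by (auto simp: matching_machine_def)
  then obtain t i where ex: "executes w \<Gamma> t i" and qt: "state_at \<Gamma> t i = q"
    using ex_run_to_state[OF m q] by blast
  have law: "recalled_law w \<Gamma> \<pi> q = (if fresh \<Gamma> t i then \<pi> else return_pmf (symbol_read \<Gamma> t i))"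
    using reading_law_recalled_law[OF m st] ex qt by (auto simp: reading_law_def)
  show ?thesis
  proof (cases "fresh \<Gamma> t i")
    case True
    then have "{x. mtrans \<Gamma> q x \<noteq> msink \<Gamma>} = UNIV"
      using standard_trans_neq_sink[OF m st ex] qt by auto
    then show ?thesis
      using True law by (simp add: pmf_map_finite sum_pmf_UNIV)
  next
    case False
    let ?a = "symbol_read \<Gamma> t i"
    have iff: "mtrans \<Gamma> q x = msink \<Gamma> \<longleftrightarrow> x \<noteq> ?a" for x
      using standard_trans_neq_sink[OF m st ex] standard_trans_eq_sink[OF m sk ex _ False] qt by auto
    \<comment> \<open>As \<open>q'\<close> is not the sink, only \<open>?a\<close> can lead to it:
      the quotient is 1 or 0, as for the point mass at \<open>?a\<close>.\<close>
    have "mtrans \<Gamma> q x = q' \<longleftrightarrow> x = ?a \<and> mtrans \<Gamma> q ?a = q'" for x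
      using iff[of x] q' by metis
    then have "{x. mtrans \<Gamma> q x = q'} = {x. x = ?a \<and> mtrans \<Gamma> q ?a = q'}"
      by (rule Collect_cong)
    then have "{x. mtrans \<Gamma> q x = q'} = (if mtrans \<Gamma> q ?a = q' then {?a} else {})"
      by (simp only: Collect_conv_if)
    moreover have sing: "{x. mtrans \<Gamma> q x \<noteq> msink \<Gamma>} = {?a}"
      by (simp add: iff)
    moreover have "pmf \<pi> ?a \<noteq> 0"
      using nz unfolding sing by simp
    ultimately show ?thesis
      using False law by (simp add: pmf_return)
  qed
qed

theorem theorem3:
  fixes w :: "'a :: finite list"
    and \<Gamma> :: "('s, 'a) machine"
    and \<pi> :: "'a pmf"
  assumes machine: "matching_machine w \<Gamma>"
    and kind: "\<not> redundant w \<Gamma> \<or> standard w \<Gamma>"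
    and sinks: "standard w \<Gamma> \<Longrightarrow> sink_like_expansion w \<Gamma>"
  shows "\<exists>\<pi>M \<delta>M.
    markov_model (mstates \<Gamma>) \<pi>M \<delta>M \<and>
    parsed_states_follow w \<Gamma> \<pi> \<pi>M \<delta>M \<and>
    (\<forall>q\<in>mstates \<Gamma>. pmf \<pi>M q = (if q = minit \<Gamma> then 1 else 0)) \<and>
    (\<not> redundant w \<Gamma> \<longrightarrow>
      (\<forall>q\<in>mstates \<Gamma>. \<forall>q'\<in>mstates \<Gamma>.
        pmf (\<delta>M q) q' = (\<Sum>x | mtrans \<Gamma> q x = q'. pmf \<pi> x))) \<and>
    (standard w \<Gamma> \<longrightarrow>
      (\<forall>q\<in>mstates \<Gamma>. \<forall>q'\<in>mstates \<Gamma> - {msink \<Gamma>}.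
        (\<Sum>x | mtrans \<Gamma> q x \<noteq> msink \<Gamma>. pmf \<pi> x) \<noteq> 0 \<longrightarrow>
        pmf (\<delta>M q) q' =
          (\<Sum>x | mtrans \<Gamma> q x = q'. pmf \<pi> x) /
          (\<Sum>x | mtrans \<Gamma> q x \<noteq> msink \<Gamma>. pmf \<pi> x)))"
proof -
  let ?\<pi>M = "return_pmf (minit \<Gamma>)"
  have model: "markov_model (mstates \<Gamma>) ?\<pi>M (\<lambda>q. map_pmf (mtrans \<Gamma> q) (D q))" for D
    using machine by (auto simp: markov_model_def matching_machine_def)
  have init: "\<forall>q\<in>mstates \<Gamma>. pmf ?\<pi>M q = (if q = minit \<Gamma> then 1 else 0)"
    by (auto simp: pmf_return)
  show ?thesis
  proof (cases "redundant w \<Gamma>")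
    case False
    have "reading_law w \<Gamma> \<pi> (\<lambda>_. \<pi>)"
      using nonredundant_fresh[OF False] by (auto simp: reading_law_def)
    note follow = parsed_states_follow_reading_law[OF this]
    \<comment> \<open>A machine may be both non-redundant and standard. Its denominators are then 1
      off the sink and 0 at it, so one model satisfies both formulas.\<close>
    have "(\<Sum>x | mtrans \<Gamma> q x \<noteq> msink \<Gamma>. pmf \<pi> x) = (if q = msink \<Gamma> then 0 else 1)"
      if "q \<in> mstates \<Gamma>" for q
      using nonredundant_avoids_sink[OF machine False, of q] machine that
      by (auto simp: sum_pmf_UNIV matching_machine_def)
    then show ?thesis
      by (intro exI[of _ ?\<pi>M] exI[of _ "\<lambda>q. map_pmf (mtrans \<Gamma> q) \<pi>"] conjI model follow init)
        (auto simp: pmf_map_finite)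
  next
    case True
    with kind have st: "standard w \<Gamma>" by blast
    show ?thesis
      using True standard_transition_law[OF machine st sinks[OF st]]
      by (intro exI[of _ ?\<pi>M] exI[of _ "\<lambda>q. map_pmf (mtrans \<Gamma> q) (recalled_law w \<Gamma> \<pi> q)"]
          conjI model init parsed_states_follow_reading_law[OF reading_law_recalled_law[OF machine st]])
        auto
  qed
qed

end
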